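(* Let $X$ and $Y$ be finite sets and $R \subseteq X \times Y$ a nonempty relation with $X = \{x \mid \exists y,\ (x,y)\in R\}$ and $Y = \{y \mid \exists x,\ (x,y)\in R\}$. Let $R^{\mathbb{Z}} = \{(x,y) \in X^{\mathbb{Z}} \times Y^{\mathbb{Z}} \mid \forall i \in \mathbb{Z},\ (x_i,y_i) \in R\}$, viewed as a subshift of $X^{\mathbb{Z}} \times Y^{\mathbb{Z}}$. Then $\mathcal{N}(R^{\mathbb{Z}}) = \mathcal{N}^{asymp}(R)$.
   Context: Finite nondeterministic communication complexity: for finite sets $X, Y$ and $S \subseteq X \times Y$, a nondeterministic protocol is a tuple $(Z, S_X, S_Y)$ with $Z$ a finite set, $S_X \subseteq X \times Z$, $S_Y \subseteq Y\times Z$, such that $(x,y) \in S \iff \exists z \in Z,\ (x,z)\in S_X,\ (y,z) \in S_Y$; its size is $\log|Z|$ and $\mathcal{N}(S)$ is the minimal size of a protocol. For $R \subseteq X\times Y$, $R^n \subseteq X^n \times Y^n$ is defined by $(x,y) \in R^n \iff \forall i < n,\ (x_i,y_i) \in R$, and the amortized (asymptotic) complexity is $\mathcal{N}^{asymp}(R) = \lim_n \frac{\mathcal{N}(R^n)}{n}$. Infinite setting: a subshift over a finite alphabet $A$ is a closed shift-invariant subset of $A^{\mathbb{Z}}$ (shift $\sigma(x)_i = x_{i+1}$); pairs of sequences are identified with sequences of pairs, so "a subshift $S \subseteq X'\times Y'$" for subshifts $X', Y'$ means a subshift of the product alphabet contained in $X'\times Y'$. The entropy of a subshift is $H(S)=\lim_n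 \frac{\log c_n}{n}$, $c_n$ being the number of words of length $n$ occurring in elements of $S$ (same logarithm base as in the finite case). A protocol for a subshift $S \subseteq X' \times Y'$ is a tuple $(Z, S_{X'}, S_{Y'})$ of subshifts with $S_{X'} \subseteq X' \times Z$, $S_{Y'} \subseteq Y' \times Z$ such that for all $(x,y) \in X'\times Y'$, $(x,y) \in S \iff \exists z\in Z,\ (x,z)\in S_{X'},\ (y,z)\in S_{Y'}$; its size is $H(Z)$, and $\mathcal{N}(S)$ is the infimum of the sizes of protocols. *)

theory Defs
  imports "HOL-Analysis.Analysis"
begin

text \<open>Logarithms are taken to base 2 throughout.\<close>

section \<open>Finite nondeterministic communication complexity\<close>

text \<open>The certificate set of a protocol is taken among sets of natural numbers. Every finite set
  is in bijection with such a set, so this does not restrict protocols up to renaming.\<close>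

definition nd_protocol ::
  "'a set \<Rightarrow> 'b set \<Rightarrow> ('a \<times> 'b) set \<Rightarrow> nat set \<Rightarrow> ('a \<times> nat) set \<Rightarrow> ('b \<times> nat) set \<Rightarrow> bool" where
  "nd_protocol X Y S Z SX SY \<longleftrightarrow>
     finite Z \<and> SX \<subseteq> X \<times> Z \<and> SY \<subseteq> Y \<times> Z \<and>
     (\<forall>x\<in>X. \<forall>y\<in>Y. (x, y) \<in> S \<longleftrightarrow> (\<exists>z\<in>Z. (x, z) \<in> SX \<and> (y, z) \<in> SY))"

text \<open>The infimum is attained, since sizes are logarithms of natural numbers. For nonempty \<open>S\<close>
  every protocol has a nonempty certificate set, so the convention \<open>log 2 0 = 0\<close> does not intervene.\<close>

definition nd_complexity :: "'a set \<Rightarrow> 'b set \<Rightarrow> ('a \<times> 'b) set \<Rightarrow> real" where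
  "nd_complexity X Y S =
     Inf {log 2 (real (card Z)) | Z SX SY. nd_protocol X Y S Z SX SY}"

definition set_power :: "'a set \<Rightarrow> nat \<Rightarrow> 'a list set" where
  "set_power X n = {xs. length xs = n \<and> set xs \<subseteq> X}"

definition rel_power ::
  "'a set \<Rightarrow> 'b set \<Rightarrow> ('a \<times> 'b) set \<Rightarrow> nat \<Rightarrow> ('a list \<times> 'b list) set" where
  "rel_power X Y R n =
     {(x, y). x \<in> set_power X n \<and> y \<in> set_power Y n \<and> (\<forall>i<n. (x ! i, y ! i) \<in> R)}"

text \<open>The limit exists for nonempty \<open>R \<subseteq> X \<times> Y\<close> with \<open>X\<close>, \<open>Y\<close> finite, by subadditivity.\<close>

definition nd_complexity_asymp :: "'a set \<Rightarrow> 'b set \<Rightarrow> ('a \<times> 'b) set \<Rightarrow> real" where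
  "nd_complexity_asymp X Y R =
     lim (\<lambda>n. nd_complexity (set_power X n) (set_power Y n) (rel_power X Y R n) / real n)"

section \<open>Subshifts\<close>

definition shift :: "(int \<Rightarrow> 'a) \<Rightarrow> int \<Rightarrow> 'a" where
  "shift x = (\<lambda>i. x (i + 1))"

definition full_shift :: "'a set \<Rightarrow> (int \<Rightarrow> 'a) set" where
  "full_shift A = {x. \<forall>i. x i \<in> A}"

definition subshift :: "'a set \<Rightarrow> (int \<Rightarrow> 'a) set \<Rightarrow> bool" where
  "subshift A S \<longleftrightarrow>
     finite A \<and> closedin (product_topology (\<lambda>_. discrete_topology A) UNIV) S \<and> shift ` S = S"

definition words :: "(int \<Rightarrow> 'a) set \<Rightarrow> nat \<Rightarrow> 'a list set" where
  "words S n = {map (\<lambda>k. x (i + int k)) [0..<n] | x i. x \<in> S}"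

text \<open>The limit exists for every subshift, by subadditivity. The entropy of the empty subshift,
  which is 0 here, never intervenes in protocols for nonempty subshifts.\<close>

definition entropy :: "(int \<Rightarrow> 'a) set \<Rightarrow> real" where
  "entropy S = lim (\<lambda>n. log 2 (real (card (words S n))) / real n)"

text \<open>Pairs of sequences are identified with sequences of pairs through \<open>pair_seq\<close>.\<close>

definition pair_seq :: "(int \<Rightarrow> 'a) \<Rightarrow> (int \<Rightarrow> 'b) \<Rightarrow> int \<Rightarrow> 'a \<times> 'b" where
  "pair_seq x y = (\<lambda>i. (x i, y i))"

definition seq_prod ::
  "(int \<Rightarrow> 'a) set \<Rightarrow> (int \<Rightarrow> 'b) set \<Rightarrow> (int \<Rightarrow> 'a \<times> 'b) set" where
  "seq_prod X' Y' = {pair_seq x y | x y. x \<in> X' \<and> y \<in> Y'}"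

section \<open>Nondeterministic complexity of subshifts\<close>

text \<open>\<open>A\<close>, \<open>B\<close>, \<open>C\<close> are the alphabets of \<open>X'\<close>, \<open>Y'\<close>, \<open>Z\<close>. As above, the finite alphabet \<open>C\<close> may be
  taken to consist of natural numbers.\<close>

definition shift_protocol ::
  "'a set \<Rightarrow> 'b set \<Rightarrow> (int \<Rightarrow> 'a) set \<Rightarrow> (int \<Rightarrow> 'b) set \<Rightarrow> (int \<Rightarrow> 'a \<times> 'b) set \<Rightarrow>
   nat set \<Rightarrow> (int \<Rightarrow> nat) set \<Rightarrow> (int \<Rightarrow> 'a \<times> nat) set \<Rightarrow> (int \<Rightarrow> 'b \<times> nat) set \<Rightarrow> bool" where
  "shift_protocol A B X' Y' S C Z SX SY \<longleftrightarrow>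
     subshift C Z \<and>
     subshift (A \<times> C) SX \<and> SX \<subseteq> seq_prod X' Z \<and>
     subshift (B \<times> C) SY \<and> SY \<subseteq> seq_prod Y' Z \<and>
     (\<forall>x\<in>X'. \<forall>y\<in>Y'. pair_seq x y \<in> S \<longleftrightarrow>
        (\<exists>z\<in>Z. pair_seq x z \<in> SX \<and> pair_seq y z \<in> SY))"

definition shift_complexity ::
  "'a set \<Rightarrow> 'b set \<Rightarrow> (int \<Rightarrow> 'a) set \<Rightarrow> (int \<Rightarrow> 'b) set \<Rightarrow> (int \<Rightarrow> 'a \<times> 'b) set \<Rightarrow> real" where
  "shift_complexity A B X' Y' S =
     Inf {entropy Z | C Z SX SY. shift_protocol A B X' Y' S C Z SX SY}"

definition rel_shift ::
  "'a set \<Rightarrow> 'b set \<Rightarrow> ('a \<times> 'b) set \<Rightarrow> (int \<Rightarrow> 'a \<times> 'b) set" where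
  "rel_shift X Y R =
     {pair_seq x y | x y. x \<in> full_shift X \<and> y \<in> full_shift Y \<and> (\<forall>i. (x i, y i) \<in> R)}"

lemma shift_image_full_shift: "shift ` full_shift A = full_shift A"
proof
  show "full_shift A \<subseteq> shift ` full_shift A"
  proof
    fix x assume "x \<in> full_shift A"
    then have "(\<lambda>i. x (i - 1)) \<in> full_shift A" "x = shift (\<lambda>i. x (i - 1))"
      by (auto simp: full_shift_def shift_def)
    then show "x \<in> shift ` full_shift A" by blast
  qed
qed (auto simp: full_shift_def shift_def)

lemma subshift_full_shift_subset:
  assumes "finite A" "B \<subseteq> A"
  shows "subshift A (full_shift B)"
proof -
  have "full_shift B = (\<Pi>\<^sub>E i\<in>UNIV. B)"
    by (auto simp: full_shift_def)
  then have "closedin (product_topology (\<lambda>_. discrete_topology A) UNIV) (full_shift B)"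
    using assms by (simp add: closedin_product_topology)
  then show ?thesis
    using assms by (simp add: subshift_def shift_image_full_shift)
qed

lemma subshift_rel_shift:
  assumes "finite X" "finite Y" "R \<subseteq> X \<times> Y"
  shows "subshift (X \<times> Y) (rel_shift X Y R)"
    and "rel_shift X Y R \<subseteq> seq_prod (full_shift X) (full_shift Y)"
proof -
  have "rel_shift X Y R = full_shift R"
  proof
    show "full_shift R \<subseteq> rel_shift X Y R"
    proof
      fix p assume p: "p \<in> full_shift R"
      have "p = pair_seq (fst \<circ> p) (snd \<circ> p)"
        by (simp add: pair_seq_def)
      moreover have "p i \<in> R" for i
        using p by (simp add: full_shift_def)
      moreover have "p i \<in> X \<times> Y" for i
        using \<open>p i \<in> R\<close> assms(3) by blast
      ultimately show "p \<in> rel_shift X Y R"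
        unfolding rel_shift_def full_shift_def
        by (intro CollectI exI[of _ "fst \<circ> p"] exI[of _ "snd \<circ> p"])
          (simp add: mem_Times_iff)
    qed
  qed (auto simp: rel_shift_def full_shift_def pair_seq_def)
  then show "subshift (X \<times> Y) (rel_shift X Y R)"
    using assms by (simp add: subshift_full_shift_subset)
qed (auto simp: rel_shift_def seq_prod_def)

end

theory Submission
  imports Defs
begin

text \<open>By Fekete's lemma the amortized complexity is the infimum of \<open>N(R\<^sup>n) / n\<close>. A protocol for \<open>R\<^sup>n\<close> with
  \<open>k\<close> certificates yields a subshift protocol of entropy at most \<open>log k / n\<close>: cut the integers into
  blocks of length \<open>n\<close> at an arbitrary phase and attach one certificate to each block. Conversely, in
  a subshift protocol \<open>Z\<close> a compactness argument gives a radius \<open>r\<close> such that agreement of the two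
  certificate sequences on \<open>[i - r, i + r]\<close> already forces \<open>(x\<^sub>i, y\<^sub>i) \<in> R\<close>, so the words of length
  \<open>n + 2 r\<close> of \<open>Z\<close> are certificates for \<open>R\<^sup>n\<close>.\<close>

section \<open>Subadditive sequences\<close>

lemma subadditive_mult_add_le:
  fixes a :: "nat \<Rightarrow> real"
  assumes "\<And>m n. a (m + n) \<le> a m + a n"
  shows "a (q * k + r) \<le> real q * a k + a r"
proof (induction q)
  case (Suc q)
  have "a (Suc q * k + r) \<le> a k + a (q * k + r)"
    using assms[of k "q * k + r"] by (simp add: algebra_simps)
  with Suc show ?case
    by (simp add: algebra_simps)
qed simp

text \<open>Fekete's lemma: divide \<open>n\<close> by a fixed \<open>k\<close> with remainder; the
  full blocks contribute at most \<open>a k / k\<close> on average and the remainder contributes a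
  bounded amount. The infimum starts at 1 because \<open>a 0 / 0\<close> evaluates to 0 and would
  distort it.\<close>

lemma subadditive_tendsto_INF:
  fixes a :: "nat \<Rightarrow> real"
  assumes sub: "\<And>m n. a (m + n) \<le> a m + a n" and nonneg: "\<And>n. 0 \<le> a n"
  shows "(\<lambda>n. a n / real n) \<longlonglongrightarrow> (INF n\<in>{1..}. a n / real n)"
    (is "_ \<longlonglongrightarrow> ?L")
proof (rule order_tendstoI)
  have bdd: "bdd_below ((\<lambda>n. a n / real n) ` {1..})"
    by (rule bdd_belowI[of _ 0]) (auto simp: nonneg)
  show "\<forall>\<^sub>F n in sequentially. c < a n / real n" if "c < ?L" for c
    using eventually_ge_at_top[of 1]
  proof eventually_elim
    case (elim n)
    then show ?case
      using cINF_lower[OF bdd, of n] that by simp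
  qed
  show "\<forall>\<^sub>F n in sequentially. a n / real n < c" if "?L < c" for c
  proof -
    have "\<exists>k\<in>{1..}. a k / real k < c"
      by (rule cINF_less_iff[THEN iffD1, OF _ bdd that]) simp
    then obtain k where k: "1 \<le> k" "a k / real k < c"
      by auto
    \<comment> \<open>One constant bounding \<open>a\<close> at every possible remainder; by
      nonnegativity the sum dominates each of its terms.\<close>
    define M where "M = (\<Sum>i<k. a i)"
    have "(\<lambda>n. a k / real k + M / real n) \<longlonglongrightarrow> a k / real k + 0"
      by (intro tendsto_intros lim_const_over_n)
    then have "\<forall>\<^sub>F n in sequentially. a k / real k + M / real n < c"
      using k(2) by (auto dest: order_tendstoD(2))
    then show ?thesis
      using eventually_ge_at_top[of 1]
    proof eventually_elim
      case (elim n)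
      have "a (n mod k) \<le> M"
        unfolding M_def using k(1) by (intro member_le_sum) (auto simp: nonneg)
      moreover have "a n \<le> real (n div k) * a k + a (n mod k)"
        using subadditive_mult_add_le[OF sub, of "n div k" k "n mod k"] by simp
      moreover have "real (n div k) * a k \<le> real n / real k * a k"
        by (intro mult_right_mono nonneg of_nat_div_le_of_nat)
      ultimately have "a n \<le> real n * (a k / real k) + M"
        by simp
      then have "a n / real n \<le> a k / real k + M / real n"
        using elim(2) by (simp add: field_simps)
      with elim(1) show ?case by linarith
    qed
  qed
qed

section \<open>Finite protocols\<close>

text \<open>The convention \<open>log 2 0 = 0\<close> keeps monotonicity at zero, so empty sets need
  no separate treatment in the size comparisons.\<close>

lemma log2_nat_mono: "log 2 (real k) \<le> log 2 (real l)" if "k \<le> l" for k l :: nat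
proof (cases "k = 0")
  case True
  then show ?thesis
    by (cases "l = 0") (auto simp: log_def)
next
  case False
  with that show ?thesis
    by (intro log_mono) auto
qed

lemma log2_nat_nonneg: "0 \<le> log 2 (real k)" for k :: nat
  using log2_nat_mono[of 0 k] by (simp add: log_def)

lemma ex_nd_protocol_card:
  assumes "finite W"
    and "\<And>x y. x \<in> X \<Longrightarrow> y \<in> Y \<Longrightarrow> (x, y) \<in> S \<longleftrightarrow> (\<exists>w\<in>W. P x w \<and> Q y w)"
  obtains Z SX SY where "nd_protocol X Y S Z SX SY" "card Z = card W"
proof -
  obtain h :: "_ \<Rightarrow> nat" where h: "inj_on h W"
    using finite_imp_inj_to_nat_seg[OF assms(1)] by blast
  have "nd_protocol X Y S (h ` W) {(x, h w) | x w. x \<in> X \<and> w \<in> W \<and> P x w}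
      {(y, h w) | y w. y \<in> Y \<and> w \<in> W \<and> Q y w}"
    unfolding nd_protocol_def using assms h by (auto simp: inj_on_eq_iff)
  moreover have "card (h ` W) = card W"
    by (rule card_image[OF h])
  ultimately show thesis
    by (rule that)
qed

lemma nd_complexity_le_log_card:
  assumes "finite W"
    and "\<And>x y. x \<in> X \<Longrightarrow> y \<in> Y \<Longrightarrow> (x, y) \<in> S \<longleftrightarrow> (\<exists>w\<in>W. P x w \<and> Q y w)"
  shows "nd_complexity X Y S \<le> log 2 (real (card W))"
proof -
  obtain Z SX SY where Z: "nd_protocol X Y S Z SX SY" "card Z = card W"
    using ex_nd_protocol_card[OF assms] by metis
  show ?thesis
    unfolding nd_complexity_def
  proof (rule cInf_lower)
    show "log 2 (real (card W)) \<in> {log 2 (real (card Z)) |Z SX SY. nd_protocol X Y S Z SX SY}"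
      using Z by (metis (mono_tags, lifting) mem_Collect_eq)
  qed (auto intro!: bdd_belowI[of _ 0] log2_nat_nonneg)
qed

text \<open>Cardinalities of certificate sets are naturals, so a least one exists once some protocol
  does, and the logarithm is monotone.\<close>

lemma nd_complexity_attained:
  assumes "finite X" "finite Y"
  obtains Z SX SY where "nd_protocol X Y S Z SX SY" "nd_complexity X Y S = log 2 (real (card Z))"
proof -
  define P where "P k \<longleftrightarrow> (\<exists>Z SX SY. nd_protocol X Y S Z SX SY \<and> card Z = k)" for k
  \<comment> \<open>The trivial protocol: the certificate is the pair itself, and each party checks
    its own coordinate.\<close>
  obtain Z SX SY where "nd_protocol X Y S Z SX SY"
    by (rule ex_nd_protocol_card[where W = "S \<inter> X \<times> Y" and X = X and Y = Y and S = S
          and P = "\<lambda>x w. fst w = x" and Q = "\<lambda>y w. snd w = y"])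
      (use assms in \<open>auto simp: Bex_def\<close>)
  then have "P (card Z)"
    by (auto simp: P_def)
  then have least: "P (Least P)"
    by (rule LeastI)
  have "nd_complexity X Y S = log 2 (real (Least P))"
    unfolding nd_complexity_def
  proof (rule cInf_eq_minimum)
    show "log 2 (real (Least P)) \<in> {log 2 (real (card Z)) |Z SX SY. nd_protocol X Y S Z SX SY}"
      using least unfolding P_def by (metis (mono_tags, lifting) mem_Collect_eq)
  next
    fix l assume "l \<in> {log 2 (real (card Z)) |Z SX SY. nd_protocol X Y S Z SX SY}"
    then obtain k where "P k" "l = log 2 (real k)"
      by (auto simp: P_def)
    then show "log 2 (real (Least P)) \<le> l"
      by (simp add: log2_nat_mono Least_le)
  qed
  with least show thesis
    unfolding P_def using that by metis
qed

section \<open>Powers of a finite relation and subadditivity of their complexity\<close>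

lemma finite_set_power: "finite X \<Longrightarrow> finite (set_power X n)"
  using finite_lists_length_eq[of X n] by (simp add: set_power_def conj_commute)

lemma rel_power_iff:
  "(x, y) \<in> rel_power X Y R n \<longleftrightarrow>
     x \<in> set_power X n \<and> y \<in> set_power Y n \<and> (\<forall>i<n. (x ! i, y ! i) \<in> R)"
  by (simp add: rel_power_def)

lemma rel_power_nonempty:
  assumes "R \<subseteq> X \<times> Y" "R \<noteq> {}"
  shows "rel_power X Y R n \<noteq> {}"
proof -
  obtain a b where "(a, b) \<in> R"
    using assms by auto
  then have "(replicate n a, replicate n b) \<in> rel_power X Y R n"
    using assms by (auto simp: rel_power_def set_power_def)
  then show ?thesis by blast
qed

lemma nd_protocol_nonempty:
  assumes "nd_protocol X Y S Z SX SY" "S \<inter> X \<times> Y \<noteq> {}"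
  shows "Z \<noteq> {}"
  using assms by (auto simp: nd_protocol_def)

lemma set_power_add_iff:
  "x \<in> set_power X (m + n) \<longleftrightarrow>
     length x = m + n \<and> take m x \<in> set_power X m \<and> drop m x \<in> set_power X n"
proof -
  have "set x = set (take m x) \<union> set (drop m x)"
    by (metis append_take_drop_id set_append)
  then show ?thesis
    by (auto simp: set_power_def)
qed

lemma rel_power_add_iff:
  assumes "x \<in> set_power X (m + n)" "y \<in> set_power Y (m + n)"
  shows "(x, y) \<in> rel_power X Y R (m + n) \<longleftrightarrow>
     (take m x, take m y) \<in> rel_power X Y R m \<and> (drop m x, drop m y) \<in> rel_power X Y R n"
proof -
  have "(\<forall>i<m + n. P i) \<longleftrightarrow> (\<forall>i<m. P i) \<and> (\<forall>i<n. P (m + i))" for P :: "nat \<Rightarrow> bool"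
    by (auto, metis le_add_diff_inverse nat_add_left_cancel_less not_less)
  then show ?thesis
    using assms by (auto simp: rel_power_iff set_power_add_iff)
qed

lemma nd_complexity_rel_power_nonneg:
  assumes "finite X" "finite Y"
  shows "0 \<le> nd_complexity (set_power X n) (set_power Y n) (rel_power X Y R n)"
proof -
  obtain Z where "nd_complexity (set_power X n) (set_power Y n) (rel_power X Y R n)
      = log 2 (real (card (Z :: nat set)))"
    using nd_complexity_attained[OF finite_set_power finite_set_power] assms by metis
  then show ?thesis
    by (simp add: log2_nat_nonneg)
qed

text \<open>A certificate for a concatenation is a pair of certificates, one for the prefix and one
  for the suffix, so sizes multiply and logarithms add.\<close>

lemma nd_complexity_rel_power_subadditive:
  assumes "finite X" "finite Y" "R \<subseteq> X \<times> Y" "R \<noteq> {}"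
  defines "N \<equiv> \<lambda>n. nd_complexity (set_power X n) (set_power Y n) (rel_power X Y R n)"
  shows "N (m + n) \<le> N m + N n"
proof -
  note fin = finite_set_power[OF assms(1)] finite_set_power[OF assms(2)]
  \<comment> \<open>Positive cardinalities are what lets the logarithm of the product split at the
    end.\<close>
  have ne: "Z \<noteq> {}" if "nd_protocol (set_power X k) (set_power Y k) (rel_power X Y R k) Z SX SY"
    for k Z SX SY
    by (rule nd_protocol_nonempty[OF that])
      (use rel_power_nonempty[OF assms(3,4), of k] in \<open>auto simp: rel_power_def\<close>)
  obtain Z1 SX1 SY1 where
    Z1: "nd_protocol (set_power X m) (set_power Y m) (rel_power X Y R m) Z1 SX1 SY1"
      "N m = log 2 (real (card Z1))"
    unfolding N_def using nd_complexity_attained[OF fin] .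
  obtain Z2 SX2 SY2 where
    Z2: "nd_protocol (set_power X n) (set_power Y n) (rel_power X Y R n) Z2 SX2 SY2"
      "N n = log 2 (real (card Z2))"
    unfolding N_def using nd_complexity_attained[OF fin] .
  have fin12: "finite Z1" "finite Z2"
    using Z1(1) Z2(1) by (auto simp: nd_protocol_def)
  have "N (m + n) \<le> log 2 (real (card (Z1 \<times> Z2)))"
    unfolding N_def
  proof (rule nd_complexity_le_log_card)
    fix x y assume xy: "x \<in> set_power X (m + n)" "y \<in> set_power Y (m + n)"
    have 1: "(take m x, take m y) \<in> rel_power X Y R m \<longleftrightarrow>
        (\<exists>z\<in>Z1. (take m x, z) \<in> SX1 \<and> (take m y, z) \<in> SY1)"
      using xy Z1(1) by (simp add: nd_protocol_def set_power_add_iff)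
    have 2: "(drop m x, drop m y) \<in> rel_power X Y R n \<longleftrightarrow>
        (\<exists>z\<in>Z2. (drop m x, z) \<in> SX2 \<and> (drop m y, z) \<in> SY2)"
      using xy Z2(1) by (simp add: nd_protocol_def set_power_add_iff)
    show "(x, y) \<in> rel_power X Y R (m + n) \<longleftrightarrow> (\<exists>w\<in>Z1 \<times> Z2.
        ((take m x, fst w) \<in> SX1 \<and> (drop m x, snd w) \<in> SX2) \<and>
        ((take m y, fst w) \<in> SY1 \<and> (drop m y, snd w) \<in> SY2))"
      unfolding rel_power_add_iff[OF xy] 1 2 by auto
  qed (use fin12 in simp)
  also have "\<dots> = N m + N n"
    using Z1(2) Z2(2) ne[OF Z1(1)] ne[OF Z2(1)] fin12
    by (simp add: card_cartesian_product log_mult card_gt_0_iff)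
  finally show ?thesis .
qed

text \<open>The infimum form serves the upper bound on the complexity of the subshift, the
  convergence form the lower bound.\<close>

lemma nd_complexity_asymp_limit:
  assumes "finite X" "finite Y" "R \<subseteq> X \<times> Y" "R \<noteq> {}"
  defines "N \<equiv> \<lambda>n. nd_complexity (set_power X n) (set_power Y n) (rel_power X Y R n)"
  shows "nd_complexity_asymp X Y R = (INF n\<in>{1..}. N n / real n)"
    and "(\<lambda>n. N n / real n) \<longlonglongrightarrow> nd_complexity_asymp X Y R"
proof -
  have *: "(\<lambda>n. N n / real n) \<longlonglongrightarrow> (INF n\<in>{1..}. N n / real n)"
    unfolding N_def
    by (intro subadditive_tendsto_INF nd_complexity_rel_power_subadditive
        nd_complexity_rel_power_nonneg assms)
  then show **: "nd_complexity_asymp X Y R = (INF n\<in>{1..}. N n / real n)"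
    unfolding nd_complexity_asymp_def N_def by (rule limI)
  show "(\<lambda>n. N n / real n) \<longlonglongrightarrow> nd_complexity_asymp X Y R"
    using * ** by simp
qed

section \<open>Subshifts and their entropy\<close>

abbreviation seq_topology :: "'a set \<Rightarrow> (int \<Rightarrow> 'a) topology" where
  "seq_topology A \<equiv> product_topology (\<lambda>_. discrete_topology A) UNIV"

lemma topspace_seq_topology: "topspace (seq_topology A) = full_shift A"
  by (auto simp: full_shift_def)

lemma subshift_subset_full_shift: "subshift A S \<Longrightarrow> S \<subseteq> full_shift A"
  unfolding subshift_def using closedin_subset topspace_seq_topology by metis

text \<open>Moving left uses that \<open>shift\<close> maps \<open>S\<close> onto \<open>S\<close>:
  the preimage provided by surjectivity is determined letter by letter.\<close>

lemma subshift_translate: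
  assumes "subshift A S" "x \<in> S"
  shows "(\<lambda>j. x (j + i)) \<in> S"
proof -
  have S: "shift ` S = S"
    using assms(1) by (simp add: subshift_def)
  have "(\<lambda>j. x (j + int n)) \<in> S \<and> (\<lambda>j. x (j - int n)) \<in> S" for n
  proof (induction n)
    case (Suc n)
    have "shift (\<lambda>j. x (j + int n)) \<in> S"
      using Suc S by blast
    moreover obtain y where y: "y \<in> S" "shift y = (\<lambda>j. x (j - int n))"
      using Suc S by (metis imageE)
    have "y j = x (j - int (Suc n))" for j
      using fun_cong[OF y(2), of "j - 1"] by (simp add: shift_def algebra_simps)
    then have "y = (\<lambda>j. x (j - int (Suc n)))"
      by blast
    ultimately show ?case
      using y(1) by (simp add: shift_def algebra_simps)
  qed (use assms in simp)
  then have "(\<lambda>j. x (j + int (nat i))) \<in> S" "(\<lambda>j. x (j - int (nat (- i)))) \<in> S"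
    by blast+
  then show ?thesis
    by (cases "0 \<le> i") auto
qed

lemma openin_finite_window:
  assumes "finite F" "\<And>x y. (\<And>i. i \<in> F \<Longrightarrow> x i = y i) \<Longrightarrow> P x \<longleftrightarrow> P y"
  shows "openin (seq_topology A) {x \<in> full_shift A. P x}"
proof (subst openin_subopen, intro ballI)
  fix x assume x: "x \<in> {x \<in> full_shift A. P x}"
  \<comment> \<open>The cylinder that fixes the letters of \<open>x\<close> on \<open>F\<close>: a
    basic open set on which \<open>P\<close> is constant.\<close>
  define U where "U = (\<Pi>\<^sub>E i\<in>UNIV. if i \<in> F then {x i} else A)"
  have "openin (seq_topology A) U"
    unfolding U_def using assms(1) x
    by (intro product_topology_basis) (auto simp: full_shift_def intro: rev_finite_subset)
  moreover have "x \<in> U"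
    using x by (auto simp: U_def full_shift_def)
  moreover have "U \<subseteq> {x \<in> full_shift A. P x}"
  proof
    fix y assume y: "y \<in> U"
    then have "y i \<in> (if i \<in> F then {x i} else A)" for i
      unfolding U_def by blast
    then have "y i \<in> A \<and> (i \<in> F \<longrightarrow> y i = x i)" for i
      using x unfolding full_shift_def
      by (metis (mono_tags, lifting) mem_Collect_eq singletonD)
    with assms(2)[of y x] x show "y \<in> {x \<in> full_shift A. P x}"
      by (simp add: full_shift_def)
  qed
  ultimately show "\<exists>T. openin (seq_topology A) T \<and> x \<in> T \<and> T \<subseteq> {x \<in> full_shift A. P x}"
    by blast
qed

lemma closedin_finite_window:
  assumes "finite F" "\<And>x y. (\<And>i. i \<in> F \<Longrightarrow> x i = y i) \<Longrightarrow> P x \<longleftrightarrow> P y"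
  shows "closedin (seq_topology A) {x \<in> full_shift A. P x}"
proof -
  have "full_shift A - {x \<in> full_shift A. P x} = {x \<in> full_shift A. \<not> P x}"
    by blast
  moreover have "openin (seq_topology A) {x \<in> full_shift A. \<not> P x}"
    by (rule openin_finite_window[OF assms(1)]) (use assms(2) in blast)
  ultimately show ?thesis
    unfolding closedin_def topspace_seq_topology by auto
qed

text \<open>The condition at each position is closed, since it reads a finite window, and shifting
  only permutes these conditions. Both kinds of subshifts in the block protocol arise in this
  way.\<close>

lemma subshift_finite_type:
  assumes "finite A" "finite F" "\<And>x y. (\<And>i. i \<in> F \<Longrightarrow> x i = y i) \<Longrightarrow> P x \<longleftrightarrow> P y"
  shows "subshift A {x \<in> full_shift A. \<forall>i. P (\<lambda>j. x (i + j))}" (is "subshift A ?S")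
proof -
  have "?S = (\<Inter>i. {x \<in> full_shift A. P (\<lambda>j. x (i + j))})"
    by auto
  moreover have "closedin (seq_topology A) {x \<in> full_shift A. P (\<lambda>j. x (i + j))}" for i
    by (rule closedin_finite_window[where F = "(+) i ` F"]) (use assms(2) in simp, rule assms(3), simp)
  ultimately have "closedin (seq_topology A) ?S"
    by (simp only:) (rule closedin_Inter, auto)
  moreover have "shift ` ?S = ?S"
  proof
    show "shift ` ?S \<subseteq> ?S"
    proof
      fix y assume "y \<in> shift ` ?S"
      then obtain x where x: "x \<in> ?S" "y = shift x" by blast
      have "P (\<lambda>j. x (i + 1 + j))" for i
        using x(1) by blast
      moreover have "(\<lambda>j. y (i + j)) = (\<lambda>j. x (i + 1 + j))" for i
        unfolding x(2) shift_def by (rule ext, rule arg_cong[where f = x]) simp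
      moreover have "y \<in> full_shift A"
        using x by (simp add: shift_def full_shift_def)
      ultimately show "y \<in> ?S"
        by simp
    qed
    show "?S \<subseteq> shift ` ?S"
    proof
      fix x assume x: "x \<in> ?S"
      then have "P (\<lambda>j. x (i - 1 + j))" for i
        by blast
      moreover have "(\<lambda>j. x (i - 1 + j)) = (\<lambda>j. x (i + j - 1))" for i
        by (rule ext, rule arg_cong[where f = x]) simp
      ultimately have "(\<lambda>i. x (i - 1)) \<in> ?S"
        using x by (simp add: full_shift_def)
      moreover have "x = shift (\<lambda>i. x (i - 1))"
        by (simp add: shift_def)
      ultimately show "x \<in> shift ` ?S" by blast
    qed
  qed
  ultimately show ?thesis
    using assms(1) by (simp add: subshift_def)
qed

section \<open>Word counts and existence of the entropy limit\<close>

lemma words_subset: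
  assumes "S \<subseteq> full_shift A"
  shows "words S n \<subseteq> {xs. set xs \<subseteq> A \<and> length xs = n}"
  using assms by (auto simp: words_def full_shift_def subset_iff)

lemma finite_words: "subshift A S \<Longrightarrow> finite (words S n)"
  using words_subset[OF subshift_subset_full_shift] finite_lists_length_eq[of A n]
  by (metis finite_subset subshift_def)

lemma card_words_pos:
  assumes "subshift A S" "S \<noteq> {}"
  shows "0 < card (words S n)"
  using assms finite_words[OF assms(1)] by (auto simp: card_gt_0_iff words_def)

lemma card_words_add_le:
  assumes "subshift A S"
  shows "card (words S (m + n)) \<le> card (words S m) * card (words S n)"
proof -
  have "words S (m + n) \<subseteq> (\<lambda>(u, v). u @ v) ` (words S m \<times> words S n)"
  proof
    fix w assume "w \<in> words S (m + n)"
    then obtain x i where x: "x \<in> S" "w = map (\<lambda>k. x (i + int k)) [0..<m + n]"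
      by (auto simp: words_def)
    have "map (\<lambda>k. x (i + int k)) [m..<m + n] = map (\<lambda>k. x (i + int m + int k)) [0..<n]"
      by (rule nth_equalityI) (auto simp: ac_simps)
    then have "w = map (\<lambda>k. x (i + int k)) [0..<m] @ map (\<lambda>k. x (i + int m + int k)) [0..<n]"
      unfolding x(2) upt_add_eq_append[of 0 m n, simplified] by simp
    then show "w \<in> (\<lambda>(u, v). u @ v) ` (words S m \<times> words S n)"
      using x(1) by (auto simp: words_def image_iff)
  qed
  then have "card (words S (m + n)) \<le> card ((\<lambda>(u, v). u @ v) ` (words S m \<times> words S n))"
    using finite_words[OF assms] by (intro card_mono) auto
  also have "\<dots> \<le> card (words S m \<times> words S n)"
    using finite_words[OF assms] by (intro card_image_le) auto
  finally show ?thesis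
    by (simp add: card_cartesian_product)
qed

lemma log_card_words_subadditive:
  assumes "subshift A S" "S \<noteq> {}"
  shows "log 2 (real (card (words S (m + n)))) \<le>
    log 2 (real (card (words S m))) + log 2 (real (card (words S n)))"
proof -
  have "log 2 (real (card (words S (m + n)))) \<le> log 2 (real (card (words S m) * card (words S n)))"
    using card_words_add_le[OF assms(1), of m n]
    by (intro log2_nat_mono)
  then show ?thesis
    using card_words_pos[OF assms, of m] card_words_pos[OF assms, of n] by (simp add: log_mult)
qed

text \<open>Nonemptiness makes all word counts positive, so their logarithms are subadditive and
  Fekete's lemma turns the formal \<open>lim\<close> into actual convergence.\<close>

lemma entropy_limit:
  assumes "subshift A S" "S \<noteq> {}"
  shows "(\<lambda>n. log 2 (real (card (words S n))) / real n) \<longlonglongrightarrow> entropy S"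
proof -
  have "convergent (\<lambda>n. log 2 (real (card (words S n))) / real n)"
    by (rule convergentI)
      (rule subadditive_tendsto_INF[OF log_card_words_subadditive[OF assms] log2_nat_nonneg])
  then show ?thesis
    unfolding entropy_def by (simp add: convergent_LIMSEQ_iff)
qed

section \<open>From finite protocols to subshift protocols\<close>

text \<open>A letter \<open>c\<close> encodes the certificate \<open>c div n\<close> together with the position \<open>c mod n\<close> inside a
  block of length \<open>n\<close>, so that along a block the letters increase by one.\<close>

definition block_step :: "nat \<Rightarrow> nat \<Rightarrow> nat \<Rightarrow> bool" where
  "block_step n a b \<longleftrightarrow> b = Suc a \<or> (n dvd Suc a \<and> n dvd b)"

definition cert_alphabet :: "nat \<Rightarrow> nat set \<Rightarrow> nat set" where
  "cert_alphabet n W = {c. c div n \<in> W}"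

definition cert_shift :: "nat \<Rightarrow> nat set \<Rightarrow> (int \<Rightarrow> nat) set" where
  "cert_shift n W = {z \<in> full_shift (cert_alphabet n W). \<forall>i. block_step n (z i) (z (i + 1))}"

text \<open>One party's relation \<open>T\<close> is tested only at letters divisible by
  \<open>n\<close>, where a block starts and its whole window is read. Block boundaries are read off
  the certificate sequence, so no phase is prescribed and shift invariance is preserved.\<close>

definition block_shift ::
  "'a set \<Rightarrow> nat \<Rightarrow> nat set \<Rightarrow> ('a list \<times> nat) set \<Rightarrow> (int \<Rightarrow> 'a \<times> nat) set" where
  "block_shift X n W T = {w \<in> full_shift (X \<times> cert_alphabet n W).
     \<forall>i. block_step n (snd (w i)) (snd (w (i + 1))) \<and>
       (n dvd snd (w i) \<longrightarrow> (map (\<lambda>k. fst (w (i + int k))) [0..<n], snd (w i) div n) \<in> T)}"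

lemma finite_cert_alphabet:
  assumes "0 < n" "finite W"
  shows "finite (cert_alphabet n W)"
proof -
  have "c \<in> (\<lambda>(w, r). n * w + r) ` (W \<times> {..<n})" if "c div n \<in> W" for c
    using that assms(1) by (intro image_eqI[of _ _ "(c div n, c mod n)"]) auto
  then have "cert_alphabet n W \<subseteq> (\<lambda>(w, r). n * w + r) ` (W \<times> {..<n})"
    by (auto simp: cert_alphabet_def)
  then show ?thesis
    using assms(2) by (auto intro: finite_subset)
qed

lemma subshift_cert_shift:
  assumes "0 < n" "finite W"
  shows "subshift (cert_alphabet n W) (cert_shift n W)"
  using subshift_finite_type[OF finite_cert_alphabet[OF assms], of "{0, 1}"
      "\<lambda>u. block_step n (u 0) (u 1)"]
  by (simp add: cert_shift_def)

lemma subshift_block_shift: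
  assumes "0 < n" "finite W" "finite X"
  shows "subshift (X \<times> cert_alphabet n W) (block_shift X n W T)"
proof -
  let ?P = "\<lambda>u. block_step n (snd (u (0::int))) (snd (u 1)) \<and>
      (n dvd snd (u 0) \<longrightarrow> (map (\<lambda>k. fst (u (int k))) [0..<n], snd (u 0) div n) \<in> T)"
  have "subshift (X \<times> cert_alphabet n W)
      {w \<in> full_shift (X \<times> cert_alphabet n W). \<forall>i. ?P (\<lambda>j. w (i + j))}"
  proof (rule subshift_finite_type[where F = "{0..int n}"])
    fix u v :: "int \<Rightarrow> 'a \<times> nat"
    assume uv: "\<And>i. i \<in> {0..int n} \<Longrightarrow> u i = v i"
    have eq: "map (\<lambda>k. fst (u (int k))) [0..<n] = map (\<lambda>k. fst (v (int k))) [0..<n]"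
      by (simp add: uv)
    have "u 0 = v 0" "u 1 = v 1"
      using assms(1) by (auto intro!: uv)
    then show "?P u \<longleftrightarrow> ?P v"
      unfolding eq by simp
  qed (use assms finite_cert_alphabet in auto)
  then show ?thesis
    by (simp add: block_shift_def)
qed

section \<open>Block structure of certificate sequences\<close>

context
  fixes n :: nat and z :: "int \<Rightarrow> nat"
  assumes n: "0 < n" and step: "\<And>i. block_step n (z i) (z (i + 1))"
begin

text \<open>Until the start of the block is reached the current letter is not divisible by
  \<open>n\<close>. This excludes a restart, so the preceding letter is smaller by one.\<close>

lemma block_step_backward: "t \<le> z i mod n \<Longrightarrow> z (i - int t) = z i - t"
proof (induction t)
  case (Suc t)
  then have IH: "z (i - int t) = z i - t" by simp
  have "z i - t = n * (z i div n) + (z i mod n - t)"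
    using Suc.prems by (metis Suc_leD add_diff_assoc mult_div_mod_eq)
  moreover have "0 < z i mod n - t" "z i mod n - t < n"
    using Suc.prems n mod_less_divisor[OF n, of "z i"] by linarith+
  ultimately have "\<not> n dvd z i - t"
    by (metis dvd_add_right_iff dvd_triv_left nat_dvd_not_less)
  with step[of "i - int t - 1"] IH have "z i - t = Suc (z (i - int t - 1))"
    by (simp add: block_step_def)
  then show ?case
    by (simp add: algebra_simps)
qed simp

lemma block_start: "n dvd z (i - int (z i mod n))"
  by (simp add: block_step_backward)

lemma block_step_forward: "n dvd z s \<Longrightarrow> t < n \<Longrightarrow> z (s + int t) = z s + t"
proof (induction t)
  case (Suc t)
  then have IH: "z (s + int t) = z s + t" by simp
  have "\<not> n dvd Suc t"
    using Suc.prems by (simp add: nat_dvd_not_less)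
  then have "\<not> n dvd z s + Suc t"
    using Suc.prems(1) by (simp add: dvd_add_right_iff del: add_Suc_right)
  with step[of "s + int t"] IH show ?case
    by (simp add: block_step_def algebra_simps)
qed simp

text \<open>The last letter of the block is \<open>z s + (n - 1)\<close>, after which both
  alternatives of \<open>block_step\<close> produce a multiple of \<open>n\<close>.\<close>

lemma block_next: "n dvd z s \<Longrightarrow> n dvd z (s + int n)"
  using step[of "s + int (n - 1)"] block_step_forward[of s "n - 1"] n
  by (auto simp: block_step_def of_nat_diff)

lemma block_next_mult: "n dvd z s \<Longrightarrow> n dvd z (s + int (q * n))"
proof (induction q)
  case (Suc q)
  then show ?case
    using block_next[of "s + int (q * n)"] by (simp add: algebra_simps)
qed simp

text \<open>Everything to the right of \<open>i\<close> is determined by the phase \<open>p\<close>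
  and the certificates at the block starts \<open>i - p + q * n\<close>. This is the decoding used
  to count words.\<close>

lemma letter_eq_block_certificate:
  fixes i :: int
  defines "p \<equiv> z i mod n"
  shows "z (i + int k) = n * (z (i - int p + int (((p + k) div n) * n)) div n) + (p + k) mod n"
proof -
  let ?s = "i - int p + int (((p + k) div n) * n)"
  have dvd: "n dvd z ?s"
    using block_next_mult[OF block_start[of i]] by (simp add: p_def)
  have "i + int k = i - int p + int (p + k)"
    by simp
  also have "\<dots> = ?s + int ((p + k) mod n)"
    by (metis add.assoc div_mult_mod_eq of_nat_add)
  finally have "z (i + int k) = z (?s + int ((p + k) mod n))"
    by (rule arg_cong)
  also have "\<dots> = z ?s + (p + k) mod n"
    using n by (intro block_step_forward[OF dvd]) simp
  finally have "z (i + int k) = z ?s + (p + k) mod n" .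
  with dvd show ?thesis by simp
qed

end

text \<open>A word is recovered from its phase, one of \<open>n\<close> values, and the certificates
  of the blocks it meets; an unaligned word can touch a partial block at either end, whence the
  extra 2.\<close>

lemma card_words_cert_shift_le:
  assumes n: "0 < n" and W: "finite W"
  shows "card (words (cert_shift n W) m) \<le> n * card W ^ (m div n + 2)"
proof -
  let ?L = "{ds. set ds \<subseteq> W \<and> length ds = m div n + 2}"
  let ?f = "\<lambda>(p, ds). map (\<lambda>k. n * (ds ! ((p + k) div n)) + (p + k) mod n) [0..<m]"
  have "words (cert_shift n W) m \<subseteq> ?f ` ({..<n} \<times> ?L)"
  proof
    fix w assume "w \<in> words (cert_shift n W) m"
    then obtain z i where z: "z \<in> cert_shift n W" and w: "w = map (\<lambda>k. z (i + int k)) [0..<m]"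
      by (auto simp: words_def)
    have step: "block_step n (z j) (z (j + 1))" and W: "z j div n \<in> W" for j
      using z by (auto simp: cert_shift_def full_shift_def cert_alphabet_def)
    define p where "p = z i mod n"
    \<comment> \<open>The certificates of the block containing \<open>i\<close> and of the next
      \<open>m div n + 1\<close> blocks; these suffice because \<open>p + k < n + m\<close> for
      \<open>k < m\<close>.\<close>
    define ds where "ds = map (\<lambda>q. z (i - int p + int (q * n)) div n) [0..<m div n + 2]"
    have "z (i + int k) = n * (ds ! ((p + k) div n)) + (p + k) mod n" if "k < m" for k
    proof -
      have "p + k < n + m"
        using that n by (simp add: p_def add_less_mono)
      then have "(p + k) div n \<le> (m + n) div n"
        by (intro div_le_mono) simp
      then have "(p + k) div n < m div n + 2"
        using n by simp
      then have "ds ! ((p + k) div n) = z (i - int p + int (((p + k) div n) * n)) div n"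
        by (simp add: ds_def del: upt_Suc)
      with letter_eq_block_certificate[where z = z, OF n step, of i k] show ?thesis
        by (simp only: p_def)
    qed
    then have "w = ?f (p, ds)"
      by (simp add: w)
    moreover have "(p, ds) \<in> {..<n} \<times> ?L"
      using n W by (auto simp: p_def ds_def)
    ultimately show "w \<in> ?f ` ({..<n} \<times> ?L)"
      by (rule image_eqI)
  qed
  moreover have "finite ({..<n} \<times> ?L)"
    using finite_lists_length_eq[OF W] by simp
  ultimately have "card (words (cert_shift n W) m) \<le> card ({..<n} \<times> ?L)"
    by (rule surj_card_le[rotated])
  also have "\<dots> = n * card W ^ (m div n + 2)"
    by (simp add: card_cartesian_product card_lists_length_eq[OF W])
  finally show ?thesis .
qed

text \<open>A word of length \<open>m\<close> meets about \<open>m / n\<close> blocks, each costing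
  at most \<open>log 2 (card W)\<close>. The phase and the two extra blocks add a constant, which
  vanishes after division by \<open>m\<close>.\<close>

lemma entropy_cert_shift_le:
  assumes n: "0 < n" and W: "finite W" and ne: "cert_shift n W \<noteq> {}"
  shows "entropy (cert_shift n W) \<le> log 2 (real (card W)) / real n"
proof -
  let ?c = "\<lambda>m. log 2 (real (card (words (cert_shift n W) m)))"
  let ?k = "log 2 (real (card W))"
  have "W \<noteq> {}"
    using ne by (auto simp: cert_shift_def full_shift_def cert_alphabet_def)
  then have k: "0 < card W"
    using W by (simp add: card_gt_0_iff)
  have "?c m / real m \<le> (log 2 (real n) + 2 * ?k) / real m + ?k / real n" if "1 \<le> m" for m
  proof -
    have "?c m \<le> log 2 (real (n * card W ^ (m div n + 2)))"
      by (rule log2_nat_mono[OF card_words_cert_shift_le[OF n W]])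
    also have "\<dots> = log 2 (real n) + real (m div n + 2) * ?k"
      using n k by (simp add: log_mult log_nat_power del: power_Suc of_nat_add power_add_numeral)
    also have "\<dots> \<le> log 2 (real n) + (real m / real n + 2) * ?k"
      using of_nat_div_le_of_nat[of m n, where ?'a = real]
      by (intro add_left_mono mult_right_mono log2_nat_nonneg) simp
    finally have "?c m / real m \<le> (log 2 (real n) + (real m / real n + 2) * ?k) / real m"
      by (rule divide_right_mono) simp
    also have "\<dots> = (log 2 (real n) + 2 * ?k) / real m + ?k / real n"
      using that n by (simp add: field_simps)
    finally show ?thesis .
  qed
  moreover have "(\<lambda>m. (log 2 (real n) + 2 * ?k) / real m + ?k / real n)
      \<longlonglongrightarrow> 0 + ?k / real n"
    by (intro tendsto_intros lim_const_over_n)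
  ultimately show ?thesis
    using entropy_limit[OF subshift_cert_shift[OF n W] ne] by (auto intro: LIMSEQ_le)
qed

section \<open>Correctness of the block protocol\<close>

lemma block_shift_subset_seq_prod:
  "block_shift X n W T \<subseteq> seq_prod (full_shift X) (cert_shift n W)"
proof
  fix w assume w: "w \<in> block_shift X n W T"
  have "w = pair_seq (\<lambda>i. fst (w i)) (\<lambda>i. snd (w i))"
    by (simp add: pair_seq_def)
  moreover have "(\<lambda>i. fst (w i)) \<in> full_shift X" "(\<lambda>i. snd (w i)) \<in> cert_shift n W"
    using w by (auto simp: block_shift_def cert_shift_def full_shift_def mem_Times_iff)
  ultimately show "w \<in> seq_prod (full_shift X) (cert_shift n W)"
    unfolding seq_prod_def by blast
qed

lemma pair_seq_block_shift_iff:
  "pair_seq x z \<in> block_shift X n W T \<longleftrightarrow>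
     x \<in> full_shift X \<and> z \<in> cert_shift n W \<and>
     (\<forall>i. n dvd z i \<longrightarrow> (map (\<lambda>k. x (i + int k)) [0..<n], z i div n) \<in> T)"
  by (auto simp: block_shift_def cert_shift_def pair_seq_def full_shift_def)

lemma map_window_mem_set_power:
  "x \<in> full_shift X \<Longrightarrow> map (\<lambda>k. x (i + int k)) [0..<n] \<in> set_power X n"
  by (auto simp: full_shift_def set_power_def)

lemma rel_power_window_iff:
  assumes "x \<in> full_shift X" "y \<in> full_shift Y"
  shows "(map (\<lambda>k. x (i + int k)) [0..<n], map (\<lambda>k. y (i + int k)) [0..<n]) \<in> rel_power X Y R n
     \<longleftrightarrow> (\<forall>k<n. (x (i + int k), y (i + int k)) \<in> R)"
  using assms by (simp add: rel_power_iff map_window_mem_set_power)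

lemma pair_seq_eq_iff: "pair_seq x y = pair_seq x' y' \<longleftrightarrow> x = x' \<and> y = y'"
  by (auto simp: pair_seq_def fun_eq_iff)

lemma rel_shift_iff:
  "pair_seq x y \<in> rel_shift X Y R \<longleftrightarrow>
     x \<in> full_shift X \<and> y \<in> full_shift Y \<and> (\<forall>i. (x i, y i) \<in> R)"
  by (auto simp: rel_shift_def pair_seq_eq_iff)

lemma shift_protocol_of_nd_protocol:
  assumes n: "0 < n" and fin: "finite X" "finite Y"
    and prot: "nd_protocol (set_power X n) (set_power Y n) (rel_power X Y R n) W TX TY"
  shows "shift_protocol X Y (full_shift X) (full_shift Y) (rel_shift X Y R)
    (cert_alphabet n W) (cert_shift n W) (block_shift X n W TX) (block_shift Y n W TY)"
proof -
  have W: "finite W"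
    using prot by (simp add: nd_protocol_def)
  have cert: "(x, y) \<in> rel_power X Y R n \<longleftrightarrow> (\<exists>w\<in>W. (x, w) \<in> TX \<and> (y, w) \<in> TY)"
    if "x \<in> set_power X n" "y \<in> set_power Y n" for x y
    using prot that by (simp add: nd_protocol_def)
  have "pair_seq x y \<in> rel_shift X Y R \<longleftrightarrow> (\<exists>z\<in>cert_shift n W.
      pair_seq x z \<in> block_shift X n W TX \<and> pair_seq y z \<in> block_shift Y n W TY)"
    if x: "x \<in> full_shift X" and y: "y \<in> full_shift Y" for x y
  proof -
    let ?u = "\<lambda>i. map (\<lambda>k. x (i + int k)) [0..<n]"
    let ?v = "\<lambda>i. map (\<lambda>k. y (i + int k)) [0..<n]"
    note cert_window = cert[OF map_window_mem_set_power[OF x] map_window_mem_set_power[OF y]]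
    note window_iff = rel_power_window_iff[OF x y, of _ n R]
    show ?thesis
    proof
      assume "pair_seq x y \<in> rel_shift X Y R"
      then have "(?u i, ?v i) \<in> rel_power X Y R n" for i
        by (simp add: rel_shift_iff window_iff)
      then have "\<exists>w\<in>W. (?u i, w) \<in> TX \<and> (?v i, w) \<in> TY" for i
        using cert_window by blast
      then obtain f where f: "f i \<in> W" "(?u i, f i) \<in> TX" "(?v i, f i) \<in> TY" for i
        by metis
      \<comment> \<open>Blocks start at the multiples of \<open>n\<close>, and each carries the
        certificate chosen for its own window; \<open>i - i mod int n\<close> is the start of the
        block containing \<open>i\<close>.\<close>
      define z where "z i = n * f (i - i mod int n) + nat (i mod int n)" for i
      have bound: "nat (i mod int n) < n" for i
        using n by (simp add: nat_less_iff)
      have z_div: "z i div n = f (i - i mod int n)" and z_mod: "z i mod n = nat (i mod int n)" for i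
        using bound[of i] n by (simp_all add: z_def)
      have z_dvd: "n dvd z i \<longleftrightarrow> i mod int n = 0" for i
        using pos_mod_sign[of "int n" i] n by (simp add: dvd_eq_mod_eq_0 z_mod order_antisym_conv)
      have "block_step n (z i) (z (i + 1))" for i
      proof (cases "(i + 1) mod int n = 0")
        \<comment> \<open>Here \<open>i\<close> is the last position of its block, so the second
          alternative of \<open>block_step\<close> applies.\<close>
        case True
        then have "int n dvd i mod int n + 1"
          by (metis mod_0_imp_dvd mod_add_left_eq)
        then have "n dvd Suc (nat (i mod int n))"
          using n by (simp add: int_dvd_int_iff[symmetric] add.commute)
        then have "n dvd n * f (i - i mod int n) + Suc (nat (i mod int n))"
          by (intro dvd_add dvd_triv_left)
        then have "n dvd Suc (z i)"
          by (simp add: z_def)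
        with True show ?thesis
          by (simp add: block_step_def z_dvd)
      next
        \<comment> \<open>The residue grows by one, so the block start, and with it the certificate,
          stays the same.\<close>
        case False
        have mod: "0 \<le> i mod int n" "i mod int n < int n"
          using n by simp_all
        have "(i + 1) mod int n = (i mod int n + 1) mod int n"
          by (simp add: mod_add_left_eq)
        moreover from this have "i mod int n + 1 \<noteq> int n"
          using False by auto
        ultimately have "(i + 1) mod int n = i mod int n + 1"
          using mod by (simp add: mod_pos_pos_trivial)
        then show ?thesis
          using mod by (simp add: block_step_def z_def nat_add_distrib)
      qed
      then have "z \<in> cert_shift n W"
        by (simp add: cert_shift_def full_shift_def cert_alphabet_def z_div f(1))
      moreover have "pair_seq x z \<in> block_shift X n W TX" "pair_seq y z \<in> block_shift Y n W TY"
        using \<open>z \<in> cert_shift n W\<close> x y f by (auto simp: pair_seq_block_shift_iff z_dvd z_div)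
      ultimately show "\<exists>z\<in>cert_shift n W.
          pair_seq x z \<in> block_shift X n W TX \<and> pair_seq y z \<in> block_shift Y n W TY"
        by blast
    next
      assume "\<exists>z\<in>cert_shift n W.
          pair_seq x z \<in> block_shift X n W TX \<and> pair_seq y z \<in> block_shift Y n W TY"
      then obtain z where z: "z \<in> cert_shift n W"
        and u: "\<And>i. n dvd z i \<Longrightarrow> (?u i, z i div n) \<in> TX"
        and v: "\<And>i. n dvd z i \<Longrightarrow> (?v i, z i div n) \<in> TY"
        by (auto simp: pair_seq_block_shift_iff)
      have step: "block_step n (z i) (z (i + 1))" and zW: "z i div n \<in> W" for i
        using z by (auto simp: cert_shift_def full_shift_def cert_alphabet_def)
      have "(x i, y i) \<in> R" for i
      proof -
        \<comment> \<open>The start of the block of \<open>z\<close> containing \<open>i\<close>,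
          whatever the phase; its certificate covers position \<open>i\<close>.\<close>
        define s where "s = i - int (z i mod n)"
        have s: "n dvd z s"
          unfolding s_def by (rule block_start[where z = z, OF n step])
        have "(?u s, ?v s) \<in> rel_power X Y R n"
          using cert_window u[OF s] v[OF s] zW by blast
        then have "\<forall>k<n. (x (s + int k), y (s + int k)) \<in> R"
          by (simp only: window_iff)
        then have "(x (s + int (z i mod n)), y (s + int (z i mod n))) \<in> R"
          using n by simp
        then show ?thesis
          by (simp add: s_def)
      qed
      then show "pair_seq x y \<in> rel_shift X Y R"
        using x y by (simp add: rel_shift_iff)
    qed
  qed
  then show ?thesis
    unfolding shift_protocol_def
    by (intro conjI ballI subshift_cert_shift subshift_block_shift block_shift_subset_seq_prod n W fin)
qed

section \<open>From subshift protocols to finite protocols\<close>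

text \<open>Serves to pull the closed sets \<open>SX\<close> and \<open>SY\<close> back along the
  projections of a sequence of pairs.\<close>

lemma continuous_map_letterwise:
  assumes "g \<in> A \<rightarrow> B"
  shows "continuous_map (seq_topology A) (seq_topology B) (\<lambda>x i. g (x i))"
proof -
  have "continuous_map (seq_topology A) (discrete_topology B) (\<lambda>x. g (x i))" for i
    using continuous_map_compose[OF continuous_map_product_projection[of i UNIV "\<lambda>_. discrete_topology A"],
        of "discrete_topology B" g] assms
    by (simp add: o_def)
  then show ?thesis
    by (simp add: continuous_map_componentwise_UNIV)
qed

text \<open>If every radius failed, the counterexamples would form a decreasing sequence of nonempty
  closed sets in a compact space. A common point has \<open>z = z'\<close> everywhere and
  contradicts soundness. Keeping \<open>z\<close> and \<open>z'\<close> separate is what later lets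
  finite words act as certificates.\<close>

lemma subshift_protocol_window:
  assumes SX: "subshift (X \<times> C) SX" and SY: "subshift (Y \<times> C) SY"
    and sound: "\<And>x y z. pair_seq x z \<in> SX \<Longrightarrow> pair_seq y z \<in> SY \<Longrightarrow> (x 0, y 0) \<in> R"
  shows "\<exists>r :: nat. \<forall>x y z z'. pair_seq x z \<in> SX \<longrightarrow> pair_seq y z' \<in> SY \<longrightarrow>
    (\<forall>j\<in>{- int r..int r}. z j = z' j) \<longrightarrow> (x 0, y 0) \<in> R"
proof (rule ccontr)
  assume neg: "\<not> ?thesis"
  let ?A = "(X \<times> C) \<times> (Y \<times> C)"
  let ?P = "\<lambda>r w. (\<forall>j\<in>{- int r..int r}. snd (fst (w j)) = snd (snd (w j))) \<and>
      (fst (fst (w 0)), fst (snd (w 0))) \<notin> R"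
  \<comment> \<open>A letter of \<open>w\<close> packs the letters of \<open>(x, z)\<close> and of
    \<open>(y, z')\<close>; \<open>D r\<close> consists of the counterexamples at radius
    \<open>r\<close>.\<close>
  define D where "D r = {w \<in> full_shift ?A. (\<lambda>i. fst (w i)) \<in> SX} \<inter>
    {w \<in> full_shift ?A. (\<lambda>i. snd (w i)) \<in> SY} \<inter> {w \<in> full_shift ?A. ?P r w}" for r :: nat
  have fst_Pi: "fst \<in> ?A \<rightarrow> X \<times> C" and snd_Pi: "snd \<in> ?A \<rightarrow> Y \<times> C"
    by auto
  have "(\<Inter>r. D r) \<noteq> {}"
  proof (rule compact_space_imp_nest)
    show "compact_space (seq_topology ?A)"
      using SX SY unfolding subshift_def
      by (simp add: compact_space_product_topology compact_space_discrete_topology)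
    show "closedin (seq_topology ?A) (D r)" for r
      unfolding D_def
    proof (intro closedin_Int)
      show "closedin (seq_topology ?A) {w \<in> full_shift ?A. ?P r w}"
        by (rule closedin_finite_window[where F = "{- int r..int r}"]) auto
      show "closedin (seq_topology ?A) {w \<in> full_shift ?A. (\<lambda>i. fst (w i)) \<in> SX}"
        using closedin_continuous_map_preimage[OF continuous_map_letterwise[of fst ?A, OF fst_Pi], of SX] SX
        unfolding subshift_def topspace_seq_topology by blast
      show "closedin (seq_topology ?A) {w \<in> full_shift ?A. (\<lambda>i. snd (w i)) \<in> SY}"
        using closedin_continuous_map_preimage[OF continuous_map_letterwise[of snd ?A, OF snd_Pi], of SY] SY
        unfolding subshift_def topspace_seq_topology by blast
    qed
    show "D r \<noteq> {}" for r
    proof -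
      obtain x y z z' where w: "pair_seq x z \<in> SX" "pair_seq y z' \<in> SY"
        "\<And>j. j \<in> {- int r..int r} \<Longrightarrow> z j = z' j" "(x 0, y 0) \<notin> R"
        using neg by blast
      then have "pair_seq (pair_seq x z) (pair_seq y z') \<in> full_shift ?A"
        using subshift_subset_full_shift[OF SX] subshift_subset_full_shift[OF SY]
        by (auto simp: full_shift_def pair_seq_def subset_iff)
      then have "pair_seq (pair_seq x z) (pair_seq y z') \<in> D r"
        using w by (simp add: D_def) (simp add: pair_seq_def)
      then show ?thesis by blast
    qed
    show "decseq D"
      by (auto simp: decseq_def D_def)
  qed
  then obtain w where w: "\<And>r. w \<in> D r"
    by blast
  let ?x = "\<lambda>i. fst (fst (w i))" and ?y = "\<lambda>i. fst (snd (w i))" and ?z = "\<lambda>i. snd (fst (w i))"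
  \<comment> \<open>Every \<open>j\<close> lies in the window of radius equal to its absolute value,
    so membership in all \<open>D r\<close> makes the two certificate sequences equal.\<close>
  have "?z j = snd (snd (w j))" for j
  proof -
    have "j \<in> {- int (nat \<bar>j\<bar>)..int (nat \<bar>j\<bar>)}"
      by auto
    then show ?thesis
      using w[of "nat \<bar>j\<bar>"] unfolding D_def by blast
  qed
  then have "(\<lambda>i. snd (w i)) = pair_seq ?y ?z" "(\<lambda>i. fst (w i)) = pair_seq ?x ?z"
    by (simp_all add: pair_seq_def fun_eq_iff prod_eq_iff)
  then have "(?x 0, ?y 0) \<in> R"
    using w[of 0] sound[of ?x ?z ?y] by (simp add: D_def)
  then show False
    using w[of 0] by (simp add: D_def)
qed

text \<open>Words of \<open>Z\<close> that overhang the block by the radius \<open>r\<close> on both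
  sides certify \<open>R\<close> on the block. The overhang costs a constant, so the average cost
  tends to the entropy.\<close>

lemma nd_complexity_asymp_le_entropy:
  assumes fin: "finite X" "finite Y" and R: "R \<subseteq> X \<times> Y" "R \<noteq> {}"
    and prot: "shift_protocol X Y (full_shift X) (full_shift Y) (rel_shift X Y R) C Z SX SY"
  shows "nd_complexity_asymp X Y R \<le> entropy Z"
proof -
  let ?N = "\<lambda>n. nd_complexity (set_power X n) (set_power Y n) (rel_power X Y R n)"
  let ?c = "\<lambda>n. log 2 (real (card (words Z n)))"
  have Z: "subshift C Z" and SX: "subshift (X \<times> C) SX" and SY: "subshift (Y \<times> C) SY"
    and sub: "SX \<subseteq> seq_prod (full_shift X) Z" "SY \<subseteq> seq_prod (full_shift Y) Z"
    using prot by (simp_all add: shift_protocol_def)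
  have cert: "pair_seq x y \<in> rel_shift X Y R \<longleftrightarrow>
      (\<exists>z\<in>Z. pair_seq x z \<in> SX \<and> pair_seq y z \<in> SY)"
    if "x \<in> full_shift X" "y \<in> full_shift Y" for x y
    using prot that by (simp add: shift_protocol_def)
  have SXD: "x \<in> full_shift X" "z \<in> Z" if "pair_seq x z \<in> SX" for x z
    using sub(1) that by (auto simp: seq_prod_def pair_seq_eq_iff)
  have SYD: "y \<in> full_shift Y" if "pair_seq y z \<in> SY" for y z
    using sub(2) that by (auto simp: seq_prod_def pair_seq_eq_iff)
  have complete: "\<exists>z\<in>Z. pair_seq x z \<in> SX \<and> pair_seq y z \<in> SY" if "\<And>i. (x i, y i) \<in> R" for x y
  proof -
    have "x \<in> full_shift X" "y \<in> full_shift Y"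
      using that R(1) by (auto simp: full_shift_def)
    with cert[of x y] that show ?thesis
      by (simp add: rel_shift_iff)
  qed
  obtain a b where ab: "(a, b) \<in> R"
    using R by auto
  then have "Z \<noteq> {}"
    using complete[of "\<lambda>_. a" "\<lambda>_. b"] by auto
  have sound: "(x 0, y 0) \<in> R" if "pair_seq x z \<in> SX" "pair_seq y z \<in> SY" for x y z
  proof -
    have "pair_seq x y \<in> rel_shift X Y R"
      using cert SXD SYD that by blast
    then show ?thesis
      by (simp add: rel_shift_iff)
  qed
  have "\<exists>r :: nat. \<forall>x y z z'. pair_seq x z \<in> SX \<longrightarrow> pair_seq y z' \<in> SY \<longrightarrow>
      (\<forall>j\<in>{- int r..int r}. z j = z' j) \<longrightarrow> (x 0, y 0) \<in> R"
    by (rule subshift_protocol_window[OF SX SY]) (rule sound)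
  then obtain r :: nat where r: "\<And>x y z z'. pair_seq x z \<in> SX \<Longrightarrow> pair_seq y z' \<in> SY \<Longrightarrow>
      \<forall>j\<in>{- int r..int r}. z j = z' j \<Longrightarrow> (x 0, y 0) \<in> R"
    by blast
  \<comment> \<open>Translation invariance moves the window criterion from position 0 to any
    \<open>i\<close>.\<close>
  have r_at: "(x i, y i) \<in> R"
    if "pair_seq x z \<in> SX" "pair_seq y z' \<in> SY"
      "\<And>j. j \<in> {i - int r..i + int r} \<Longrightarrow> z j = z' j" for x y z z' i
  proof -
    have "pair_seq (\<lambda>j. x (j + i)) (\<lambda>j. z (j + i)) \<in> SX"
      "pair_seq (\<lambda>j. y (j + i)) (\<lambda>j. z' (j + i)) \<in> SY"
      using subshift_translate[OF SX that(1), of i] subshift_translate[OF SY that(2), of i]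
      by (simp_all add: pair_seq_def)
    from r[OF this] that(3) show ?thesis
      by simp
  qed
  have N_le: "?N n \<le> ?c (n + 2 * r)" for n
  proof (rule nd_complexity_le_log_card)
    \<comment> \<open>Positions from \<open>- r\<close> to \<open>n + r - 1\<close>, which contain
      the radius \<open>r\<close> neighbourhood of each position of the block.\<close>
    let ?win = "\<lambda>z. map (\<lambda>k. z (- int r + int k)) [0..<n + 2 * r]"
    \<comment> \<open>Each party accepts \<open>w\<close> if some bi-infinite extension of its own
      input has a certificate sequence showing \<open>w\<close>; the two parties may extend
      \<open>w\<close> differently.\<close>
    let ?P = "\<lambda>S x w. \<exists>x' z. pair_seq x' z \<in> S \<and> x = map (\<lambda>k. x' (int k)) [0..<n] \<and> w = ?win z"
    show "finite (words Z (n + 2 * r))"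
      by (rule finite_words[OF Z])
    fix x y assume x: "x \<in> set_power X n" and y: "y \<in> set_power Y n"
    show "(x, y) \<in> rel_power X Y R n \<longleftrightarrow> (\<exists>w\<in>words Z (n + 2 * r). ?P SX x w \<and> ?P SY y w)"
    proof
      assume xy: "(x, y) \<in> rel_power X Y R n"
      \<comment> \<open>Padding both inputs with one fixed pair \<open>(a, b)\<close> of
        \<open>R\<close> keeps the extended sequences related at every position.\<close>
      define x' where "x' i = (if 0 \<le> i \<and> i < int n then x ! nat i else a)" for i
      define y' where "y' i = (if 0 \<le> i \<and> i < int n then y ! nat i else b)" for i
      have "(x' i, y' i) \<in> R" for i
        using xy ab by (auto simp: x'_def y'_def rel_power_iff)
      from complete[of x' y', OF this] obtain z where z: "z \<in> Z" "pair_seq x' z \<in> SX" "pair_seq y' z \<in> SY"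
        by blast
      have "?win z \<in> words Z (n + 2 * r)"
        using z(1) unfolding words_def by blast
      moreover have "x = map (\<lambda>k. x' (int k)) [0..<n]" "y = map (\<lambda>k. y' (int k)) [0..<n]"
        using x y by (auto simp: set_power_def x'_def y'_def intro!: nth_equalityI)
      ultimately show "\<exists>w\<in>words Z (n + 2 * r). ?P SX x w \<and> ?P SY y w"
        using z(2,3) by blast
    next
      assume "\<exists>w\<in>words Z (n + 2 * r). ?P SX x w \<and> ?P SY y w"
      then obtain x' z y' z' where
        x': "pair_seq x' z \<in> SX" "x = map (\<lambda>k. x' (int k)) [0..<n]" and
        y': "pair_seq y' z' \<in> SY" "y = map (\<lambda>k. y' (int k)) [0..<n]" and
        win: "?win z = ?win z'"
        by auto
      have zz': "z j = z' j" if "- int r \<le> j" "j < int n + int r" for j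
      proof -
        have "nat (j + int r) < n + 2 * r"
          using that by linarith
        then have "?win z ! nat (j + int r) = z j" "?win z' ! nat (j + int r) = z' j"
          using that by simp_all
        with win show ?thesis by metis
      qed
      have "(x' (int i), y' (int i)) \<in> R" if "i < n" for i
        by (rule r_at[OF x'(1) y'(1)]) (use that in \<open>auto intro!: zz'\<close>)
      with x y x'(2) y'(2) show "(x, y) \<in> rel_power X Y R n"
        by (simp add: rel_power_iff)
    qed
  qed
  have "?N n / real n \<le> ?c n / real n + ?c (2 * r) / real n" for n
    using order_trans[OF N_le[of n] log_card_words_subadditive[OF Z \<open>Z \<noteq> {}\<close>, of n "2 * r"]]
    by (simp add: divide_right_mono flip: add_divide_distrib)
  moreover have "(\<lambda>n. ?c n / real n + ?c (2 * r) / real n) \<longlonglongrightarrow> entropy Z + 0"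
    by (intro tendsto_intros lim_const_over_n entropy_limit[OF Z \<open>Z \<noteq> {}\<close>])
  ultimately show ?thesis
    using nd_complexity_asymp_limit(2)[OF fin R] by (auto intro: LIMSEQ_le)
qed

section \<open>Equality of the two complexities\<close>

theorem theorem4p1:
  fixes X :: "'a set" and Y :: "'b set" and R :: "('a \<times> 'b) set"
  assumes "finite X" and "finite Y"
    and "R \<subseteq> X \<times> Y" and "R \<noteq> {}"
    and "X = {x. \<exists>y. (x, y) \<in> R}" and "Y = {y. \<exists>x. (x, y) \<in> R}"
  shows "shift_complexity X Y (full_shift X) (full_shift Y) (rel_shift X Y R)
           = nd_complexity_asymp X Y R"
proof (rule antisym)
  let ?N = "\<lambda>n. nd_complexity (set_power X n) (set_power Y n) (rel_power X Y R n)"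
  let ?E = "{entropy Z | C Z SX SY.
    shift_protocol X Y (full_shift X) (full_shift Y) (rel_shift X Y R) C Z SX SY}"
  have lower: "nd_complexity_asymp X Y R \<le> e" if "e \<in> ?E" for e
    using that nd_complexity_asymp_le_entropy[OF assms(1-4)] by blast
  have upper: "\<exists>e\<in>?E. e \<le> ?N n / real n" if n: "0 < n" for n
  proof -
    obtain W TX TY where
      W: "nd_protocol (set_power X n) (set_power Y n) (rel_power X Y R n) W TX TY"
        "?N n = log 2 (real (card W))"
      using nd_complexity_attained[OF finite_set_power finite_set_power] assms(1,2) by metis
    note prot = shift_protocol_of_nd_protocol[OF n assms(1,2) W(1)]
    obtain a b where "(a, b) \<in> R"
      using assms(3,4) by auto
    then have "pair_seq (\<lambda>_. a) (\<lambda>_. b) \<in> rel_shift X Y R"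
      "(\<lambda>_. a) \<in> full_shift X" "(\<lambda>_. b) \<in> full_shift Y"
      using assms(3) by (auto simp: rel_shift_iff full_shift_def)
    \<comment> \<open>A constant pair in \<open>rel_shift X Y R\<close> needs a certificate
      sequence; nonemptiness is required by the entropy estimate.\<close>
    then have "cert_shift n W \<noteq> {}"
      using prot unfolding shift_protocol_def by blast
    then have "entropy (cert_shift n W) \<le> ?N n / real n"
      using entropy_cert_shift_le[OF n] W by (simp add: nd_protocol_def)
    then show ?thesis
      using prot by blast
  qed
  \<comment> \<open>\<open>lower\<close> supplies the boundedness from below that an infimum of
    reals requires.\<close>
  have "Inf ?E \<le> ?N n / real n" if "0 < n" for n
    using upper[OF that] lower by (meson bdd_belowI cInf_lower2)
  then show "shift_complexity X Y (full_shift X) (full_shift Y) (rel_shift X Y R)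
      \<le> nd_complexity_asymp X Y R"
    unfolding shift_complexity_def nd_complexity_asymp_limit(1)[OF assms(1-4)]
    by (intro cINF_greatest) auto
  \<comment> \<open>The case \<open>n = 1\<close> of \<open>upper\<close> enters only to show that
    some protocol exists, so that the infimum is over a nonempty set.\<close>
  show "nd_complexity_asymp X Y R
      \<le> shift_complexity X Y (full_shift X) (full_shift Y) (rel_shift X Y R)"
    unfolding shift_complexity_def using upper[of 1] lower by (intro cInf_greatest) auto
qed

end
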